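(* Every finite graph $G$ has a cycle $C$ with $$\Delta(G\setminus C)\leq \tfrac{1}{2}|G\setminus C|.$$
   Context: A single vertex, a single edge, and the empty set are all considered to be cycles. $G\setminus C$ denotes the induced subgraph of $G$ on $V(G)\setminus V(C)$, $|G\setminus C|$ its number of vertices and $\Delta$ the maximum degree; the maximum degree of the graph with no vertices is taken to be $-\tfrac12$. *)

theory Defs
  imports Complex_Main "Graph_Theory.Digraph_Component"
begin

text \<open>
  Finite simple graphs are the digraphs of the locale \<open>graph\<close> (finite, loop-free, without parallel
  arcs, symmetric): an undirected edge \<open>uv\<close> is a pair of opposite arcs, so the degree of a vertex is
  its \<open>out_degree\<close>.
\<close>

definition proper_cycle :: "('a, 'b) pre_digraph \<Rightarrow> bool" where
  "proper_cycle C \<longleftrightarrow>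
     (\<exists>p. pre_digraph.cycle C p \<and> 3 \<le> length p \<and>
        verts C = tail C ` set p \<and>
        arcs_ends C = arc_to_ends C ` set p \<union> (arc_to_ends C ` set p)\<inverse>)"

text \<open>
  The library's \<open>cycle\<close> admits the closed arc walk of length 2 running back and forth along an edge;
  \<open>proper_cycle\<close> excludes it, and the degenerate cycles are listed explicitly below.
\<close>

definition cycle_graph :: "('a, 'b) pre_digraph \<Rightarrow> bool" where
  "cycle_graph C \<longleftrightarrow> graph C \<and>
     (verts C = {} \<or>
      (\<exists>v. verts C = {v}) \<or>
      (\<exists>u v. u \<noteq> v \<and> verts C = {u, v} \<and> arcs_ends C = {(u, v), (v, u)}) \<or>
      proper_cycle C)"

definition remove_subgraph :: "('a, 'b) pre_digraph \<Rightarrow> ('a, 'b) pre_digraph \<Rightarrow> ('a, 'b) pre_digraph"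
  where "remove_subgraph G C = G \<restriction> (verts G - verts C)"

definition max_degree :: "('a, 'b) pre_digraph \<Rightarrow> real" where
  "max_degree G =
     (if verts G = {} then - (1 / 2) else real (Max (out_degree G ` verts G)))"

end

theory Submission
  imports Defs
begin

text \<open>
  Grow a path \<open>P\<close> with end vertices \<open>p\<close>, \<open>q\<close> (possibly equal) such that, for \<open>H = G \<setminus> P\<close> and
  \<open>n = |H|\<close>, both ends have at least \<open>n/2\<close> neighbours in \<open>H\<close> and at least \<open>n + 1\<close> in total. If some
  \<open>x\<close> in \<open>H\<close> has degree at least \<open>n/2\<close> in \<open>H\<close>, then \<open>P\<close> can be extended to \<open>x\<close>, directly or through
  a common neighbour of \<open>x\<close> and an end of \<open>P\<close>, so that the degree conditions persist. If there is no
  such \<open>x\<close>, then \<open>\<Delta>(H) \<le> (n - 1)/2\<close>, and a common neighbour of \<open>p\<close> and \<open>q\<close> in \<open>H\<close> closes \<open>P\<close>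
  to a cycle, which leaves \<open>n - 1\<close> vertices.
\<close>

section \<open>Degrees into a vertex set\<close>

definition deg_in :: "('a \<Rightarrow> 'a \<Rightarrow> bool) \<Rightarrow> 'a set \<Rightarrow> 'a \<Rightarrow> nat" where
  "deg_in R H v = card {y \<in> H. R v y}"

lemma deg_in_remove:
  assumes "finite H" "x \<in> H"
  shows "deg_in R H v = deg_in R (H - {x}) v + (if R v x then 1 else 0)"
proof -
  have "{y \<in> H. R v y} = (if R v x then insert x {y \<in> H - {x}. R v y} else {y \<in> H - {x}. R v y})"
    using assms by auto
  then show ?thesis
    using assms by (auto simp: deg_in_def)
qed

lemma deg_in_mono: "finite H \<Longrightarrow> H' \<subseteq> H \<Longrightarrow> deg_in R H' v \<le> deg_in R H v"
  unfolding deg_in_def by (intro card_mono) auto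

text \<open>Pigeonhole: two disjoint neighbourhoods of this total size would not fit into
  \<open>H\<close>.\<close>

lemma common_neighbour:
  assumes "finite H" "card H < deg_in R H u + deg_in R H v"
  obtains w where "w \<in> H" "R u w" "R v w"
proof (rule ccontr)
  assume "\<not> thesis"
  with that have "{y \<in> H. R u y} \<inter> {y \<in> H. R v y} = {}" by blast
  then have "deg_in R H u + deg_in R H v = card ({y \<in> H. R u y} \<union> {y \<in> H. R v y})"
    using assms(1) unfolding deg_in_def by (intro card_Un_disjoint[symmetric]) auto
  also have "\<dots> \<le> card H"
    using assms(1) by (intro card_mono) auto
  finally show False using assms(2) by simp
qed

section \<open>Growing a path with rich ends\<close>

definition simple_path :: "('a \<Rightarrow> 'a \<Rightarrow> bool) \<Rightarrow> 'a set \<Rightarrow> 'a list \<Rightarrow> bool" where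
  "simple_path R V vs \<longleftrightarrow> vs \<noteq> [] \<and> distinct vs \<and> set vs \<subseteq> V \<and> successively R vs"

text \<open>With n = \<open>card H\<close>, the strict bound on the sum gives the ends a common
  neighbour and forces degree at least (n + 1)/2 on one of them. The separate bounds n/2 keep the
  other end usable when a new vertex becomes an end.\<close>

definition rich_ends :: "('a \<Rightarrow> 'a \<Rightarrow> bool) \<Rightarrow> 'a set \<Rightarrow> 'a list \<Rightarrow> bool" where
  "rich_ends R H vs \<longleftrightarrow>
     card H \<le> 2 * deg_in R H (hd vs) \<and> card H \<le> 2 * deg_in R H (last vs) \<and>
     card H < deg_in R H (hd vs) + deg_in R H (last vs)"

lemma simple_path_rev:
  assumes "symp R" "simple_path R V vs"
  shows "simple_path R V (rev vs)"
proof -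
  have "successively (\<lambda>x y. R y x) vs"
    using assms(2) sympD[OF assms(1)] unfolding simple_path_def by (blast intro: successively_mono)
  then show ?thesis using assms(2) by (simp add: simple_path_def)
qed

lemma rich_ends_rev: "vs \<noteq> [] \<Longrightarrow> rich_ends R H (rev vs) \<longleftrightarrow> rich_ends R H vs"
  by (auto simp: rich_ends_def hd_rev last_rev)

text \<open>With n = \<open>card (V - set vs)\<close>, the head has degree at least (n + 1)/2 there,
  so it can spare one neighbour. It stays an end and \<open>x\<close> is attached behind
  \<open>last vs\<close>, unless \<open>hd vs\<close> is the only end adjacent to \<open>x\<close>.
  Assumption \<open>le\<close> costs no generality, since paths can be reversed.\<close>

lemma extend_path:
  assumes fin: "finite V" and sym: "symp R" and irr: "irreflp R"
    and path: "simple_path R V vs" and rich: "rich_ends R (V - set vs) vs"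
    and x: "x \<in> V - set vs" and deg_x: "card (V - set vs) \<le> 2 * deg_in R (V - set vs) x"
    and le: "deg_in R (V - set vs) (last vs) \<le> deg_in R (V - set vs) (hd vs)"
  shows "\<exists>us. simple_path R V us \<and> rich_ends R (V - set us) us \<and> set vs \<subset> set us"
proof -
  define H where "H = V - set vs"
  have finH: "finite H" using fin by (simp add: H_def)
  have ne: "vs \<noteq> []" using path by (simp add: simple_path_def)
  have nxx: "\<not> R x x" using irr by (simp add: irreflp_def)
  have xH: "x \<in> H" using x by (simp add: H_def)
  have cardH: "card H = card (H - {x}) + 1" using finH xH by (metis card_Suc_Diff1 Suc_eq_plus1)
  have Rsym: "R u v \<longleftrightarrow> R v u" for u v using sym by (auto simp: symp_def)
  have rm_le: "deg_in R H v \<le> deg_in R (H - {x}) v + 1" for v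
    using deg_in_remove[OF finH xH, of R v] by simp
  have rm_eq: "deg_in R (H - {x}) v = deg_in R H v" if "\<not> R v x" for v
    using deg_in_remove[OF finH xH, of R v] that by simp
  have rich': "card H \<le> 2 * deg_in R H (hd vs)" "card H \<le> 2 * deg_in R H (last vs)"
    "card H < deg_in R H (hd vs) + deg_in R H (last vs)"
    "card H \<le> 2 * deg_in R H x" "deg_in R H (last vs) \<le> deg_in R H (hd vs)"
    using rich deg_x le unfolding rich_ends_def H_def by auto
  consider (last) "R (last vs) x" | (hd) "\<not> R (last vs) x" "R (hd vs) x"
    | (none) "\<not> R (last vs) x" "\<not> R (hd vs) x" by blast
  then show ?thesis
  proof cases
    \<comment> \<open>\<open>hd vs\<close> keeps at least (n - 1)/2 neighbours, and
      \<open>x\<close>, not being its own neighbour, keeps n/2. The total n - 1/2 exceeds the new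
      size n - 1.\<close>
    case last
    have eq: "V - set (vs @ [x]) = H - {x}" by (auto simp: H_def)
    have "simple_path R V (vs @ [x])"
      using path x last by (auto simp: simple_path_def successively_append_iff)
    moreover have "rich_ends R (V - set (vs @ [x])) (vs @ [x])"
      using rich' rm_le[of "hd vs"] rm_eq[OF nxx] cardH
      unfolding rich_ends_def eq hd_append2[OF ne] last_snoc by linarith
    ultimately show ?thesis using x by (intro exI[of _ "vs @ [x]"]) auto
  next
    \<comment> \<open>The remaining end \<open>last vs\<close> is not adjacent to \<open>x\<close>,
      so both new ends keep n/2 neighbours, and n exceeds n - 1.\<close>
    case hd
    have eq: "V - set (x # vs) = H - {x}" by (auto simp: H_def)
    have "simple_path R V (x # vs)"
      using path x hd Rsym[of x] by (auto simp: simple_path_def successively_Cons)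
    moreover have "rich_ends R (V - set (x # vs)) (x # vs)"
      using rich' rm_eq[OF hd(1)] rm_eq[OF nxx] cardH
      unfolding rich_ends_def eq list.sel last_ConsR[OF ne] by linarith
    ultimately show ?thesis using x by (intro exI[of _ "x # vs"]) auto
  next
    case none
    have fin': "finite (H - {x})" using finH by simp
    \<comment> \<open>Neither vertex has \<open>x\<close> as a neighbour, so both keep n/2
      neighbours among only n - 1 vertices.\<close>
    have "card (H - {x}) < deg_in R (H - {x}) (last vs) + deg_in R (H - {x}) x"
      using rich' rm_eq[OF none(1)] rm_eq[OF nxx] cardH by linarith
    then obtain w where w: "w \<in> H - {x}" "R (last vs) w" "R x w"
      by (rule common_neighbour[OF fin'])
    have cardH': "card (H - {x}) = card (H - {x} - {w}) + 1"
      using fin' w(1) by (metis card_Suc_Diff1 Suc_eq_plus1)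
    have rm_le': "deg_in R (H - {x}) v \<le> deg_in R (H - {x} - {w}) v + 1" for v
      using deg_in_remove[OF fin' w(1), of R v] by simp
    have eq: "V - set (vs @ [w, x]) = H - {x} - {w}" by (auto simp: H_def)
    have "simple_path R V (vs @ [w, x])"
      using path x w Rsym[of x] by (auto simp: simple_path_def successively_append_iff H_def)
    \<comment> \<open>Each end loses at most \<open>w\<close>: at least (n - 1)/2 and n/2 - 1
      neighbours remain, and their total n - 3/2 exceeds the new size n - 2.\<close>
    moreover have "rich_ends R (V - set (vs @ [w, x])) (vs @ [w, x])"
      using rich' rm_eq[OF none(2)] rm_eq[OF nxx] rm_le'[of "hd vs"] rm_le'[of x] cardH cardH'
      unfolding rich_ends_def eq hd_append2[OF ne] last_append
      by (simp del: One_nat_def)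
    ultimately show ?thesis using x by (intro exI[of _ "vs @ [w, x]"]) auto
  qed
qed

text \<open>A list of length 1 stands for the one-vertex cycle.\<close>

lemma cycle_with_sparse_complement:
  assumes fin: "finite V" and sym: "symp R" and irr: "irreflp R"
    and path: "simple_path R V vs" and rich: "rich_ends R (V - set vs) vs"
  shows "\<exists>us. simple_path R V us \<and> (length us = 1 \<or> 3 \<le> length us \<and> R (last us) (hd us)) \<and>
    (\<forall>x \<in> V - set us. 2 * deg_in R (V - set us) x \<le> card (V - set us))"
  using path rich
proof (induction "card (V - set vs)" arbitrary: vs rule: less_induct)
  case less
  define H where "H = V - set vs"
  have finH: "finite H" using fin by (simp add: H_def)
  have ne: "vs \<noteq> []" using less.prems by (simp add: simple_path_def)
  show ?case
  proof (cases "\<exists>x\<in>H. card H \<le> 2 * deg_in R H x")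
    case True
    then obtain x where x: "x \<in> V - set vs" "card (V - set vs) \<le> 2 * deg_in R (V - set vs) x"
      by (auto simp: H_def)
    have "\<exists>us. simple_path R V us \<and> rich_ends R (V - set us) us \<and> set vs \<subset> set us"
    proof (cases "deg_in R H (last vs) \<le> deg_in R H (hd vs)")
      case True
      then show ?thesis
        using extend_path[OF fin sym irr less.prems x] by (simp add: H_def)
    next
      \<comment> \<open>Reversing the path puts the end of smaller degree last.\<close>
      case False
      then show ?thesis
        using extend_path[OF fin sym irr simple_path_rev[OF sym less.prems(1)], of x]
          less.prems(2) x ne
        by (simp add: H_def rich_ends_rev hd_rev last_rev)
    qed
    then obtain us where us: "simple_path R V us" "rich_ends R (V - set us) us" "set vs \<subset> set us"
      by blast
    then have "V - set us \<subset> V - set vs" by (auto simp: simple_path_def)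
    then have "card (V - set us) < card (V - set vs)" using fin by (intro psubset_card_mono) auto
    then show ?thesis using less.hyps us by blast
  next
    case False
    \<comment> \<open>Integrality gives a slack of one, which pays for the vertex \<open>w\<close>
      removed from \<open>H\<close> when the cycle is closed.\<close>
    then have small: "2 * deg_in R H x + 1 \<le> card H" if "x \<in> H" for x
      using that by force
    show ?thesis
    proof (cases "length vs = 1")
      \<comment> \<open>The two ends coincide, so a common neighbour would close no proper cycle;
        the single vertex is taken as the cycle.\<close>
      case True
      then show ?thesis
        using less.prems add_leD1[OF small] by (intro exI[of _ vs]) (auto simp: H_def)
    next
      case False
      with ne have len: "2 \<le> length vs" by (cases vs) (auto simp: Suc_le_eq)
      have "card H < deg_in R H (hd vs) + deg_in R H (last vs)"
        using less.prems(2) by (simp add: rich_ends_def H_def)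
      then obtain w where w: "w \<in> H" "R (hd vs) w" "R (last vs) w"
        by (rule common_neighbour[OF finH])
      have eq: "V - set (vs @ [w]) = H - {w}" by (auto simp: H_def)
      have cardH: "card H = card (H - {w}) + 1" using finH w by (metis card_Suc_Diff1 Suc_eq_plus1)
      have "2 * deg_in R (H - {w}) x \<le> card (H - {w})" if "x \<in> H - {w}" for x
        using small[of x] that cardH deg_in_mono[OF finH, of "H - {w}" R x] by auto
      moreover have "simple_path R V (vs @ [w])"
        using less.prems w by (auto simp: simple_path_def successively_append_iff H_def)
      moreover have "R w (hd vs)" using w sym by (auto simp: symp_def)
      ultimately show ?thesis
        using len ne unfolding eq[symmetric] by (intro exI[of _ "vs @ [w]"]) auto
    qed
  qed
qed

section \<open>Translation to digraphs\<close>

context graph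
begin

text \<open>Without parallel arcs, \<open>head G\<close> maps the arcs leaving \<open>x\<close>
  bijectively onto its neighbours.\<close>

lemma out_degree_induce_subgraph:
  assumes "x \<in> H"
  shows "out_degree (G \<restriction> H) x = deg_in (dominates G) H x"
proof -
  have "bij_betw (head G) (out_arcs (G \<restriction> H) x) {y \<in> H. x \<rightarrow>\<^bsub>G\<^esub> y}"
    unfolding bij_betw_def
  proof
    show "inj_on (head G) (out_arcs (G \<restriction> H) x)"
      by (auto intro!: inj_onI no_multi_arcs simp: out_arcs_def arc_to_ends_def)
    show "head G ` out_arcs (G \<restriction> H) x = {y \<in> H. x \<rightarrow>\<^bsub>G\<^esub> y}"
      using assms by (force simp: out_arcs_def arcs_ends_conv)
  qed
  then show ?thesis by (simp add: out_degree_def deg_in_def bij_betw_same_card)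
qed

lemma max_degree_induce_subgraph_le:
  assumes "H \<subseteq> verts G" "\<And>x. x \<in> H \<Longrightarrow> 2 * deg_in (dominates G) H x \<le> card H"
  shows "max_degree (G \<restriction> H) \<le> 1 / 2 * real (card H)"
proof (cases "H = {}")
  case True
  \<comment> \<open>The default value -1/2 is below the right-hand side 0.\<close>
  then show ?thesis by (simp add: max_degree_def)
next
  case False
  have "finite H" using assms(1) finite_verts by (rule finite_subset)
  then have "Max (out_degree (G \<restriction> H) ` H) \<in> out_degree (G \<restriction> H) ` H"
    using False by (intro Max_in) auto
  then obtain x where "x \<in> H" "Max (out_degree (G \<restriction> H) ` H) = deg_in (dominates G) H x"
    by (auto simp: out_degree_induce_subgraph)
  then show ?thesis using assms(2)[of x] False by (simp add: max_degree_def)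
qed

text \<open>Passes from vertex lists to the arc lists on which \<open>cycle\<close> is defined,
  choosing one arc per consecutive pair.\<close>

lemma successively_imp_awalk:
  assumes "vs \<noteq> []" "successively (dominates G) vs" "set vs \<subseteq> verts G"
  shows "\<exists>p. awalk (hd vs) p (last vs) \<and> awalk_verts (hd vs) p = vs"
  using assms
proof (induction vs)
  case Nil
  then show ?case by simp
next
  case (Cons v vs)
  show ?case
  proof (cases "vs = []")
    case True
    then show ?thesis using Cons.prems by (intro exI[of _ "[]"]) (auto simp: awalk_def)
  next
    case False
    then obtain p where p: "awalk (hd vs) p (last vs)" "awalk_verts (hd vs) p = vs"
      using Cons by (auto simp: successively_Cons)
    obtain e where e: "e \<in> arcs G" "tail G e = v" "head G e = hd vs"
      using Cons.prems False by (auto simp: successively_Cons arcs_ends_conv)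
    show ?thesis
      using p e False by (intro exI[of _ "e # p"]) (auto simp: awalk_Cons_iff)
  qed
qed

text \<open>Selecting arcs by their end pairs keeps \<open>G\<close> free of loops and parallel
  arcs; symmetry comes from \<open>S\<close>.\<close>

lemma graph_of_symmetric_arcs:
  assumes "V \<subseteq> verts G" "S \<subseteq> arcs_ends G" "sym S" "S \<subseteq> V \<times> V"
  defines "C \<equiv> \<lparr>verts = V, arcs = {e \<in> arcs G. arc_to_ends G e \<in> S}, tail = tail G, head = head G\<rparr>"
  shows "graph C" "subgraph C G" "arcs_ends C = S"
proof -
  show ends: "arcs_ends C = S"
    using assms(2) by (auto simp: C_def arcs_ends_def arc_to_ends_def)
  have "finite V" using assms(1) finite_verts by (rule finite_subset)
  then show graph: "graph C"
    using assms(3,4) no_loops no_multi_arcs ends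
    by unfold_locales (auto simp: C_def arc_to_ends_def symmetric_def)
  then interpret C: graph C .
  show "subgraph C G"
    using assms(1) C.wf_digraph wf_digraph by (auto simp: C_def subgraph_def compatible_def)
qed

text \<open>Repeating the first vertex at the end gives a closed arc walk \<open>p\<close>; its arcs
  and their opposites form the cycle.\<close>

lemma cycle_graph_of_list:
  assumes path: "simple_path (dominates G) (verts G) vs"
    and len: "3 \<le> length vs" and close: "last vs \<rightarrow>\<^bsub>G\<^esub> hd vs"
  shows "\<exists>C. subgraph C G \<and> cycle_graph C \<and> verts C = set vs"
proof -
  have ne: "vs \<noteq> []" using len by auto
  have "successively (dominates G) (vs @ [hd vs])" "set (vs @ [hd vs]) \<subseteq> verts G"
    using path ne close by (auto simp: simple_path_def successively_append_iff)
  then obtain p where walk: "awalk (hd vs) p (hd vs)" and verts: "awalk_verts (hd vs) p = vs @ [hd vs]"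
    using successively_imp_awalk[of "vs @ [hd vs]"] ne by auto
  have p_ne: "p \<noteq> []" using verts ne by auto
  then have tails: "map (tail G) p = vs"
    using verts by (simp add: awalk_verts_conv)
  have "insert (hd vs) (set vs) = tail G ` set p \<union> head G ` set p"
    using set_awalk_verts_not_Nil_cas[of "hd vs" p "hd vs"] walk p_ne verts by (simp add: awalk_def)
  then have heads: "head G ` set p \<subseteq> set vs"
    using hd_in_set[OF ne] by (metis Un_upper2 insert_absorb)
  have p_arcs: "set p \<subseteq> arcs G" using walk by (auto simp: awalk_def)
  define S where "S = arc_to_ends G ` set p \<union> (arc_to_ends G ` set p)\<inverse>"
  define C where "C = \<lparr>verts = set vs, arcs = {e \<in> arcs G. arc_to_ends G e \<in> S},
    tail = tail G, head = head G\<rparr>"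
  have tail_set: "tail G ` set p = set vs" using tails by (metis set_map)
  have "arc_to_ends G ` set p \<subseteq> arcs_ends G" using p_arcs by (auto simp: arcs_ends_def)
  then have S_arcs: "S \<subseteq> arcs_ends G"
    using sym_arcs by (auto simp: S_def symmetric_def dest: symD)
  have S_sym: "sym S" by (auto simp: S_def sym_def)
  have S_verts: "S \<subseteq> set vs \<times> set vs"
    using tail_set heads by (auto simp: S_def arc_to_ends_def)
  have "set vs \<subseteq> verts G" using path by (simp add: simple_path_def)
  note C = graph_of_symmetric_arcs[OF this S_arcs S_sym S_verts, folded C_def]
  \<comment> \<open>\<open>C\<close> shares \<open>tail\<close> and \<open>head\<close> with
    \<open>G\<close>, so the walk carries over unchanged.\<close>
  have compat: "compatible C G" by (simp add: C_def compatible_def)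
  have "set p \<subseteq> arcs C" using p_arcs by (auto simp: C_def S_def)
  then have "pre_digraph.awalk C (hd vs) p (hd vs)"
    using walk ne compatible_cas[OF compat] by (auto simp: pre_digraph.awalk_def C_def)
  moreover have "pre_digraph.awalk_verts C (hd vs) p = vs @ [hd vs]"
    using verts compatible_awalk_verts[OF compat] by simp
  \<comment> \<open>\<open>cycle\<close> tests distinctness after dropping the first entry, so the
    repeated \<open>hd vs\<close> counts once.\<close>
  moreover have "distinct (tl (vs @ [hd vs]))"
    using path by (cases vs) (auto simp: simple_path_def)
  ultimately have "pre_digraph.cycle C p"
    using p_ne by (auto simp: pre_digraph.cycle_def)
  moreover have "3 \<le> length p" using len tails by (metis length_map)
  moreover have "verts C = tail C ` set p" using tail_set by (simp add: C_def)
  moreover have "arc_to_ends C = arc_to_ends G" by (auto simp: C_def arc_to_ends_def)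
  ultimately have "proper_cycle C"
    using C(3) unfolding proper_cycle_def S_def by metis
  then show ?thesis using C by (intro exI[of _ C]) (auto simp: cycle_graph_def C_def)
qed

lemma trivial_cycle_graph:
  assumes "V \<subseteq> verts G" "V = {} \<or> V = {v}"
  shows "\<exists>C. subgraph C G \<and> cycle_graph C \<and> verts C = V"
proof -
  \<comment> \<open>This is the construction of \<open>graph_of_symmetric_arcs\<close> for the empty
    set of pairs: no edges.\<close>
  define C where "C = \<lparr>verts = V, arcs = {e \<in> arcs G. arc_to_ends G e \<in> {}},
    tail = tail G, head = head G\<rparr>"
  have "graph C" "subgraph C G"
    using graph_of_symmetric_arcs[OF assms(1), of "{}"] by (auto simp: C_def sym_def)
  then show ?thesis using assms(2) by (intro exI[of _ C]) (auto simp: cycle_graph_def C_def)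
qed

end

section \<open>The cycle in a given graph\<close>

theorem theorem2p1:
  fixes G :: "('a, 'b) pre_digraph"
  assumes "graph G"
  shows "\<exists>C. subgraph C G \<and> cycle_graph C \<and>
    max_degree (remove_subgraph G C) \<le> 1 / 2 * real (card (verts (remove_subgraph G C)))"
proof -
  interpret graph G by fact
  have sym: "symp (dominates G)" using sym_arcs by (auto simp: symp_def symmetric_def dest: symD)
  have irr: "irreflp (dominates G)" using no_loops by (auto simp: irreflp_def arcs_ends_conv)
  have "\<exists>C. subgraph C G \<and> cycle_graph C \<and> (\<forall>x \<in> verts G - verts C.
    2 * deg_in (dominates G) (verts G - verts C) x \<le> card (verts G - verts C))"
  proof (cases "\<exists>v\<in>verts G. card (verts G) \<le> 2 * deg_in (dominates G) (verts G) v")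
    case True
    then obtain v where v: "v \<in> verts G" "card (verts G) \<le> 2 * deg_in (dominates G) (verts G) v"
      by blast
    have "\<not> v \<rightarrow>\<^bsub>G\<^esub> v" using irr by (simp add: irreflp_def)
    moreover have "card (verts G) = card (verts G - {v}) + 1"
      using v by (metis card_Suc_Diff1 Suc_eq_plus1 finite_verts)
    \<comment> \<open>\<open>v\<close> is both ends of the path and loses no neighbour: twice its
      degree is at least \<open>card (verts G)\<close>, one more than the vertices left.\<close>
    ultimately have "rich_ends (dominates G) (verts G - set [v]) [v]"
      using v deg_in_remove[OF finite_verts v(1), of "dominates G" v] by (auto simp: rich_ends_def)
    moreover have "simple_path (dominates G) (verts G) [v]" using v by (simp add: simple_path_def)
    ultimately obtain us where us: "simple_path (dominates G) (verts G) us"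
      "length us = 1 \<or> 3 \<le> length us \<and> last us \<rightarrow>\<^bsub>G\<^esub> hd us"
      "\<forall>x \<in> verts G - set us.
         2 * deg_in (dominates G) (verts G - set us) x \<le> card (verts G - set us)"
      using cycle_with_sparse_complement[OF finite_verts sym irr] by blast
    have "\<exists>C. subgraph C G \<and> cycle_graph C \<and> verts C = set us"
      using us(2)
    proof
      assume "length us = 1"
      then obtain u where "us = [u]" by (auto simp: length_Suc_conv)
      then show ?thesis using us(1) trivial_cycle_graph[of "{u}" u] by (simp add: simple_path_def)
    next
      assume "3 \<le> length us \<and> last us \<rightarrow>\<^bsub>G\<^esub> hd us"
      then show ?thesis using us(1) cycle_graph_of_list by blast
    qed
    then show ?thesis using us(3) by metis
  next
    case False
    \<comment> \<open>Every degree is below half the number of vertices, so the empty cycle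
      suffices.\<close>
    obtain C where "subgraph C G" "cycle_graph C" "verts C = {}"
      using trivial_cycle_graph[of "{}"] by auto
    with False show ?thesis by (intro exI[of _ C]) force
  qed
  then obtain C where C: "subgraph C G" "cycle_graph C" "\<And>x. x \<in> verts G - verts C \<Longrightarrow>
    2 * deg_in (dominates G) (verts G - verts C) x \<le> card (verts G - verts C)"
    by blast
  have "max_degree (remove_subgraph G C) \<le> 1 / 2 * real (card (verts (remove_subgraph G C)))"
    using max_degree_induce_subgraph_le[OF Diff_subset C(3)] by (simp add: remove_subgraph_def)
  with C(1,2) show ?thesis by blast
qed

end
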